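(* Let $(X^i,y_i)\in\mathbb{R}^m\times\mathbb{R}$, $i=1,\dots,N$, be given data, $t>0$, $h_N>0$, and let $A$ be a positive definite covariance matrix of size $(m+1)\times(m+1)$. Let $K$ be the normal kernel on $\mathbb{R}^{m+1}$ with covariance $A$. Then the smoothed regression problem $$\min_{\tilde\beta}\ \sum_{i=1}^N\int_{\mathbb{R}^{m+1}}\big(\tilde\beta^\top\tilde x\big)^2K\Big(\frac{\tilde X^i-\tilde x}{h_N}\Big)\frac{1}{h_N^{m+1}}\,d\tilde x\quad\text{subject to}\quad\sum_{j=1}^m|\beta_j|\le t,$$ where $\tilde\beta=(-1,\beta)$ with $\beta\in\mathbb{R}^m$ and $\tilde X^i=(y_i,X^i)$, is equivalent to a regularization in the objective, i.e. to the problem $$\min_{\beta\in\mathbb{R}^m}\ \sum_{i=1}^N\big(y_i-\beta^\top X^i\big)^2+\kappa\,\|(-1,\beta)\|_A^2\quad\text{subject to}\quad\sum_{j=1}^m|\beta_j|\le t,$$ with $\kappa=h_N^2$.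
   Context: The data consist of $N$ observations of an outcome $y_i$ and an $m$-dimensional vector $X^i$ of explanatory variables; the intercept of the linear model is taken to be $0$. The number $h_N$ is the bandwidth. The normal kernel on $\mathbb{R}^{m+1}$ with covariance $A$ is $K(z)=\frac{1}{\sqrt{(2\pi)^{m+1}|A|}}\,e^{-\frac12z^\top A^{-1}z}$, where $|A|=\det A$. The norm $\|\cdot\|_A$ is the weighted Euclidean norm, $\|v\|_A^2=v^\top Av$ for $v\in\mathbb{R}^{m+1}$.
   Formalization: The sum over i is taken to include the regularization term, so the penalty has total weight N·h_N²; with the penalty added only once, the claim with κ = h_N² fails for N ≥ 2. *)

theory Defs
  imports "HOL-Analysis.Analysis"
begin

definition pos_def_matrix :: "real^'n^'n \<Rightarrow> bool" where
  "pos_def_matrix A \<longleftrightarrow> transpose A = A \<and> (\<forall>v. v \<noteq> 0 \<longrightarrow> v \<bullet> (A *v v) > 0)"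

definition normal_kernel :: "real^'n^'n \<Rightarrow> real^'n \<Rightarrow> real" where
  "normal_kernel A z =
     1 / sqrt ((2 * pi) ^ CARD('n) * det A) * exp (- (1/2) * (z \<bullet> (matrix_inv A *v z)))"

definition weighted_norm :: "real^'n^'n \<Rightarrow> real^'n \<Rightarrow> real" where
  "weighted_norm A v = sqrt (v \<bullet> (A *v v))"

text \<open>Vectors of dimension \<open>m + 1\<close> are indexed by \<^typ>\<open>'m option\<close>: the index \<^const>\<open>None\<close> is the
  extra leading coordinate, and \<open>Some j\<close> is the coordinate \<open>j\<close> of the \<open>m\<close>-dimensional part.\<close>

definition prepend :: "real \<Rightarrow> real^'m \<Rightarrow> real^('m option)" where
  "prepend c v = (\<chi> k. case k of None \<Rightarrow> c | Some j \<Rightarrow> v $ j)"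

definition l1_ball :: "real \<Rightarrow> (real^'m) set" where
  "l1_ball t = {\<beta>. (\<Sum>j\<in>UNIV. \<bar>\<beta> $ j\<bar>) \<le> t}"

definition smoothed_integrand ::
  "real^('m option)^('m option) \<Rightarrow> real \<Rightarrow> real^'m \<Rightarrow> real \<Rightarrow> real^'m \<Rightarrow> real^('m option) \<Rightarrow> real"
where
  "smoothed_integrand A h X y \<beta> x =
     (prepend (-1) \<beta> \<bullet> x)\<^sup>2 * normal_kernel A ((1 / h) *\<^sub>R (prepend y X - x)) * (1 / h ^ (CARD('m) + 1))"

definition smoothed_objective ::
  "real^('m option)^('m option) \<Rightarrow> real \<Rightarrow> nat \<Rightarrow> (nat \<Rightarrow> real^'m) \<Rightarrow> (nat \<Rightarrow> real) \<Rightarrow> real^'m \<Rightarrow> real"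
where
  "smoothed_objective A h N X y \<beta> =
     (\<Sum>i=1..N. integral\<^sup>L lborel (smoothed_integrand A h (X i) (y i) \<beta>))"

text \<open>The sum over the observations ranges over the regularization term as well. If the term were
  added only once, the weight corresponding to bandwidth \<open>h\<close> would be \<open>N * h\<^sup>2\<close>, not \<open>h\<^sup>2\<close>.\<close>

definition regularized_objective ::
  "real^('m option)^('m option) \<Rightarrow> real \<Rightarrow> nat \<Rightarrow> (nat \<Rightarrow> real^'m) \<Rightarrow> (nat \<Rightarrow> real) \<Rightarrow> real^'m \<Rightarrow> real"
where
  "regularized_objective A \<kappa> N X y \<beta> =
     (\<Sum>i=1..N. ((y i - \<beta> \<bullet> X i)\<^sup>2 + \<kappa> * (weighted_norm A (prepend (-1) \<beta>))\<^sup>2))"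

definition minimizers :: "'a set \<Rightarrow> ('a \<Rightarrow> real) \<Rightarrow> 'a set" where
  "minimizers S f = {x \<in> S. \<forall>z\<in>S. f x \<le> f z}"

text \<open>The optimal value is an extended real so that it is meaningful also for objectives that are
  unbounded below and for empty feasible sets.\<close>

definition optimal_value :: "'a set \<Rightarrow> ('a \<Rightarrow> real) \<Rightarrow> ereal" where
  "optimal_value S f = (INF x\<in>S. ereal (f x))"

definition equivalent_problems :: "'a set \<Rightarrow> ('a \<Rightarrow> real) \<Rightarrow> 'a set \<Rightarrow> ('a \<Rightarrow> real) \<Rightarrow> bool" where
  "equivalent_problems S f T g \<longleftrightarrow>
     S = T \<and> minimizers S f = minimizers T g \<and> optimal_value S f = optimal_value T g"

end

theory Submission imports Defs "HOL-Probability.Distributions" begin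

text \<open>A factorization \<open>A = S S\<^sup>T\<close> and the substitution \<open>x = X - h S w\<close> turn the smoothed term into the
  integral of \<open>(b \<bullet> X + v \<bullet> w)\<^sup>2\<close> against the standard normal density, where \<open>v = - h S\<^sup>T b\<close>. Its
  first moments vanish and its second moments are the identity, so the value is
  \<open>(b \<bullet> X)\<^sup>2 + \<bar>v\<bar>\<^sup>2 = (b \<bullet> X)\<^sup>2 + h\<^sup>2 (b \<bullet> A b)\<close>. Hence the two objectives are the same function.\<close>

subsection \<open>Linear substitution in Lebesgue integrals\<close>

text \<open>The change of variables theorems of HOL-Analysis require a well-ordered index type, which
  \<^typ>\<open>'m option\<close> is not for an arbitrary finite \<^typ>\<open>'m\<close>.\<close>

lemma nn_integral_lborel_shear:
  fixes f :: "'a::euclidean_space \<Rightarrow> ennreal"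
  assumes [measurable]: "f \<in> borel_measurable borel"
    and "a \<in> Basis" "b \<in> Basis" "a \<noteq> b"
  shows "(\<integral>\<^sup>+x. f (x + (c * (x \<bullet> b)) *\<^sub>R a) \<partial>lborel) = (\<integral>\<^sup>+x. f x \<partial>lborel)"
proof -
  interpret product_sigma_finite "\<lambda>_::'a. lborel :: real measure"
    by unfold_locales
  define I where "I = Basis - {a}"
  have I: "finite I" "a \<notin> I" "Basis = insert a I" "b \<in> I"
    using assms by (auto simp: I_def)
  \<comment> \<open>The coordinate along \<open>a\<close> is integrated first, with all others,
    including the one along \<open>b\<close>, held fixed.\<close>
  have Fubini: "(\<integral>\<^sup>+x. g x \<partial>lborel) =
      (\<integral>\<^sup>+x. (\<integral>\<^sup>+y. g (y *\<^sub>R a + (\<Sum>k\<in>I. x k *\<^sub>R k)) \<partial>lborel) \<partial>(\<Pi>\<^sub>M k\<in>I. lborel))"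
    if [measurable]: "g \<in> borel_measurable borel" for g :: "'a \<Rightarrow> ennreal"
  proof -
    have "(\<Sum>k\<in>I. (x(a := y)) k *\<^sub>R k) = (\<Sum>k\<in>I. x k *\<^sub>R k)" for x :: "'a \<Rightarrow> real" and y
      using I by (intro sum.cong) auto
    moreover have "(\<lambda>x. g (\<Sum>k\<in>Basis. x k *\<^sub>R k)) \<in> borel_measurable (\<Pi>\<^sub>M k\<in>insert a I. lborel)"
      using I(3) by simp
    moreover have "(\<integral>\<^sup>+x. g x \<partial>lborel) = (\<integral>\<^sup>+x. g (\<Sum>k\<in>Basis. x k *\<^sub>R k) \<partial>(\<Pi>\<^sub>M k\<in>Basis. lborel))"
      by (subst lborel_eq) (simp add: nn_integral_distr)
    ultimately show ?thesis
      using I(1,2) unfolding I(3) by (simp add: product_nn_integral_insert del: fun_upd_apply) simp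
  qed
  \<comment> \<open>For fixed \<open>s\<close> the coefficient is
    \<open>c * (s \<bullet> b)\<close>, as \<open>a\<close> and \<open>b\<close> are orthogonal. The
    shear only moves \<open>y\<close> by a constant, so translation invariance on the line
    applies.\<close>
  have "(\<integral>\<^sup>+y. f (y *\<^sub>R a + s + (c * ((y *\<^sub>R a + s) \<bullet> b)) *\<^sub>R a) \<partial>lborel) =
      (\<integral>\<^sup>+y. f (y *\<^sub>R a + s) \<partial>lborel)" for s
  proof -
    have "(\<integral>\<^sup>+y. f (y *\<^sub>R a + s) \<partial>lborel) = (\<integral>\<^sup>+y. f ((c * (s \<bullet> b) + 1 * y) *\<^sub>R a + s) \<partial>lborel)"
      by (subst nn_integral_real_affine[where c = 1 and t = "c * (s \<bullet> b)"]) auto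
    then show ?thesis
      using assms by (simp add: inner_left_distrib inner_not_same_Basis algebra_simps)
  qed
  then show ?thesis
    by (simp add: Fubini)
qed

lemma
  fixes f :: "real^'n \<Rightarrow> 'b::comm_monoid_add" and g :: "real^'n \<Rightarrow> 'c::comm_monoid_mult"
  shows sum_Basis_vec: "sum f Basis = (\<Sum>i\<in>UNIV. f (axis i 1))"
    and prod_Basis_vec: "prod g Basis = (\<Prod>i\<in>UNIV. g (axis i 1))"
proof -
  have "(Basis :: (real^'n) set) = (\<lambda>i. axis i 1) ` UNIV"
    by (auto simp: Basis_vec_def)
  moreover have "inj (\<lambda>i::'n. axis i (1::real))"
    by (auto simp: inj_def axis_eq_axis)
  ultimately show "sum f Basis = (\<Sum>i\<in>UNIV. f (axis i 1))" "prod g Basis = (\<Prod>i\<in>UNIV. g (axis i 1))"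
    using sum.reindex[of "\<lambda>i. axis i 1" UNIV f] prod.reindex[of "\<lambda>i. axis i 1" UNIV g]
    by (simp_all only: o_def)
qed

text \<open>Lebesgue measure is determined by its values on boxes, and a coordinate swap only
  reorders the side lengths of a box.\<close>

lemma nn_integral_lborel_swap:
  fixes f :: "real^'n \<Rightarrow> ennreal"
  assumes [measurable]: "f \<in> borel_measurable borel"
  shows "(\<integral>\<^sup>+x. f (\<chi> i. x $ Transposition.transpose m n i) \<partial>lborel) = (\<integral>\<^sup>+x. f x \<partial>lborel)"
proof -
  let ?T = "\<lambda>x::real^'n. \<chi> i. x $ Transposition.transpose m n i"
  have [measurable]: "?T \<in> borel_measurable borel"
    by (intro borel_measurable_continuous_onI continuous_intros)
  have "lborel = distr lborel borel ?T"
  proof (rule lborel_eqI)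
    fix l u :: "real^'n"
    assume "\<And>b. b \<in> Basis \<Longrightarrow> l \<bullet> b \<le> u \<bullet> b"
    then have le: "l $ i \<le> u $ i" for i
      by (metis axis_in_Basis_iff inner_axis insertI1 real_inner_1_right Basis_real_def)
    have "?T -` box l u = box (?T l) (?T u)"
      by (auto simp: mem_box_cart) (metis transpose_involutory)+
    moreover have "?T l \<bullet> b \<le> ?T u \<bullet> b" if "b \<in> Basis" for b
      using that le by (auto simp: Basis_vec_def inner_axis)
    ultimately have "emeasure (distr lborel borel ?T) (box l u) = (\<Prod>i\<in>UNIV. (u - l) $ Transposition.transpose m n i)"
      by (simp add: emeasure_distr emeasure_lborel_box_eq prod_Basis_vec inner_axis)
    also have "\<dots> = (\<Prod>i\<in>UNIV. (u - l) $ i)"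
      using prod.permute[OF permutes_swap_id, where S = UNIV and g = "\<lambda>i. (u - l) $ i"]
      by (simp add: o_def)
    finally show "emeasure (distr lborel borel ?T) (box l u) = (\<Prod>b\<in>Basis. (u - l) \<bullet> b)"
      by (simp add: prod_Basis_vec inner_axis)
  qed simp
  then have "(\<integral>\<^sup>+x. f x \<partial>lborel) = (\<integral>\<^sup>+x. f x \<partial>distr lborel borel ?T)"
    by simp
  then show ?thesis
    by (simp add: nn_integral_distr)
qed

lemma nn_integral_lborel_diagonal:
  fixes f :: "real^'n \<Rightarrow> ennreal"
    and c :: "'n \<Rightarrow> real"
  assumes [measurable]: "f \<in> borel_measurable borel" and "\<And>i. c i \<noteq> 0"
  shows "(\<integral>\<^sup>+x. f x \<partial>lborel) = ennreal \<bar>\<Prod>i\<in>UNIV. c i\<bar> * (\<integral>\<^sup>+x. f (\<chi> i. c i * x $ i) \<partial>lborel)"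
proof -
  \<comment> \<open>\<open>lborel_affine_euclidean\<close> wants factors indexed by basis vectors;
    on \<open>axis i 1\<close> this sum collapses to \<open>c i\<close>.\<close>
  let ?c = "\<lambda>b. \<Sum>i\<in>UNIV. c i * b $ i"
  have c: "?c (axis i 1) = c i" for i :: 'n
    by (simp add: axis_def if_distrib cong: if_cong)
  have T: "(\<Sum>b\<in>Basis. (?c b * (x \<bullet> b)) *\<^sub>R b) = (\<chi> i. c i * x $ i)" for x :: "real^'n"
  proof -
    have "axis j 1 $ i = (if i = j then 1 else (0::real))" for i j :: 'n
      by (simp add: axis_def)
    then have "c j * x $ j * axis j 1 $ i = (if j = i then c i * x $ i else 0)" for i j
      by simp
    then show ?thesis
      by (simp add: sum_Basis_vec c inner_axis vec_eq_iff)
  qed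
  have P: "(\<Prod>b\<in>Basis. \<bar>?c b\<bar>) = \<bar>\<Prod>i\<in>UNIV. c i\<bar>"
    by (simp add: prod_Basis_vec c abs_prod)
  have [measurable]: "(\<lambda>x::real^'n. \<chi> i. c i * x $ i) \<in> borel_measurable borel"
    by (intro borel_measurable_continuous_onI continuous_intros)
  have "?c b \<noteq> 0" if "b \<in> Basis" for b :: "real^'n"
    using that assms(2) by (auto simp: Basis_vec_def c)
  then have "lborel = density (distr lborel borel (\<lambda>x. \<chi> i. c i * x $ i)) (\<lambda>_. ennreal \<bar>\<Prod>i\<in>UNIV. c i\<bar>)"
    using lborel_affine_euclidean[of ?c 0] by (simp add: T P)
  then have "(\<integral>\<^sup>+x. f x \<partial>lborel) =
      (\<integral>\<^sup>+x. f x \<partial>density (distr lborel borel (\<lambda>x. \<chi> i. c i * x $ i)) (\<lambda>_. ennreal \<bar>\<Prod>i\<in>UNIV. c i\<bar>))"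
    by (rule arg_cong)
  then show ?thesis
    by (simp add: nn_integral_density nn_integral_distr nn_integral_cmult)
qed

text \<open>The formula passes to matrix products because the determinant is multiplicative, so
  elementary matrices suffice: scalings, swaps and shears.\<close>

lemma nn_integral_lborel_matrix:
  fixes A :: "real^'n^'n" and f :: "real^'n \<Rightarrow> ennreal"
  assumes "det A \<noteq> 0" and "f \<in> borel_measurable borel"
  shows "(\<integral>\<^sup>+x. f x \<partial>lborel) = ennreal \<bar>det A\<bar> * (\<integral>\<^sup>+x. f (A *v x) \<partial>lborel)"
proof -
  \<comment> \<open>The induction also meets singular matrices, so the determinant condition is a
    premise; it makes the zero-row case vacuous. All \<open>f\<close> are quantified because the
    product case applies the hypothesis on \<open>B\<close> to \<open>f\<close> composed with
    \<open>A\<close>.\<close>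
  define P where "P A \<longleftrightarrow> (det A \<noteq> 0 \<longrightarrow> (\<forall>f \<in> borel_measurable borel.
      (\<integral>\<^sup>+x. f x \<partial>lborel) = ennreal \<bar>det A\<bar> * (\<integral>\<^sup>+x. f (A *v x) \<partial>lborel)))" for A :: "real^'n^'n"
  have "P A"
  proof (rule induct_matrix_elementary)
    fix A B :: "real^'n^'n"
    assume AB: "P A" "P B"
    show "P (A ** B)"
      unfolding P_def
    proof (intro impI ballI)
      fix f :: "real^'n \<Rightarrow> ennreal"
      assume det: "det (A ** B) \<noteq> 0" and [measurable]: "f \<in> borel_measurable borel"
      have "(\<lambda>x. A *v x) \<in> borel_measurable borel"
        by (intro borel_measurable_continuous_onI matrix_vector_mult_linear_continuous_on)
      from this[measurable] have "(\<lambda>x. f (A *v x)) \<in> borel_measurable borel"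
        by measurable
      with AB det show "(\<integral>\<^sup>+x. f x \<partial>lborel) =
          ennreal \<bar>det (A ** B)\<bar> * (\<integral>\<^sup>+x. f (A ** B *v x) \<partial>lborel)"
        by (simp add: P_def det_mul abs_mult ennreal_mult matrix_vector_mul_assoc[symmetric] mult.assoc)
    qed
  next
    fix A :: "real^'n^'n" and i
    assume "row i A = 0"
    then show "P A"
      by (simp add: P_def det_zero_row)
  next
    fix A :: "real^'n^'n"
    assume diag: "\<And>i j. i \<noteq> j \<Longrightarrow> A $ i $ j = 0"
    then have det: "det A = (\<Prod>i\<in>UNIV. A $ i $ i)"
      by (rule det_diagonal)
    have "A *v x = (\<chi> i. A $ i $ i * x $ i)" for x
    proof -
      have "(\<Sum>j\<in>UNIV. A $ i $ j * x $ j) = (\<Sum>j\<in>UNIV. if j = i then A $ i $ i * x $ i else 0)" for i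
        using diag by (intro sum.cong) auto
      then show ?thesis
        by (simp add: matrix_vector_mult_def)
    qed
    then show "P A"
      using nn_integral_lborel_diagonal[of _ "\<lambda>i. A $ i $ i"] by (auto simp: P_def det)
  next
    fix m n :: 'n
    assume "m \<noteq> n"
    let ?A = "(\<chi> i j. mat 1 $ i $ Transposition.transpose m n j) :: real^'n^'n"
    have "?A *v x = (\<chi> i. x $ Transposition.transpose m n i)" for x
    proof -
      have "(if i = Transposition.transpose m n j then 1 else 0) * x $ j =
          (if j = Transposition.transpose m n i then x $ j else 0)" for i j
        by auto
      then show ?thesis
        by (simp add: matrix_vector_mult_def mat_def)
    qed
    moreover have "\<bar>det ?A\<bar> = 1"
      by (simp add: det_permute_columns permutes_swap_id sign_swap_id abs_mult)
    ultimately show "P ?A"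
      by (simp add: P_def nn_integral_lborel_swap)
  next
    fix m n :: 'n and c :: real
    assume mn: "m \<noteq> n"
    let ?A = "(\<chi> i j. if i = m \<and> j = n then c else of_bool (i = j)) :: real^'n^'n"
    have "?A *v x = x + (c * (x \<bullet> axis n 1)) *\<^sub>R axis m 1" for x
    proof -
      have "?A $ i $ j * x $ j = (if j = i then x $ i else 0) + (if j = n then if i = m then c * x $ n else 0 else 0)" for i j
        using mn by auto
      then have "(?A *v x) $ i = x $ i + (if i = m then c * x $ n else 0)" for i
        unfolding matrix_vector_mult_def by (simp add: sum.distrib)
      then show ?thesis
        unfolding inner_axis by (simp add: vec_eq_iff axis_def)
    qed
    \<comment> \<open>Read by rows, the shear arises from the identity by adding \<open>c\<close>
      times row \<open>n\<close> to row \<open>m\<close>, which preserves the determinant.\<close>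
    moreover have "?A = (\<chi> k. if k = m then row m (mat 1) + c *s row n (mat 1) else row k (mat 1))"
      using mn by (auto simp: vec_eq_iff row_def mat_def)
    then have "det ?A = 1"
      using det_row_operation[OF mn, of "mat 1" c] by simp
    ultimately show "P ?A"
      using mn by (simp add: P_def nn_integral_lborel_shear axis_eq_axis)
  qed
  with assms show ?thesis
    by (simp add: P_def)
qed

text \<open>As an identity of measures the substitution carries over from nonnegative to
  Banach-valued integrands. Translation invariance removes \<open>t\<close>; the linear formula is
  then applied to a shifted indicator.\<close>

lemma lborel_affine_matrix:
  fixes A :: "real^'n^'n"
  assumes "det A \<noteq> 0"
  shows "lborel = density (distr lborel borel (\<lambda>x. t + A *v x)) (\<lambda>_. ennreal \<bar>det A\<bar>)"
proof (rule measure_eqI)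
  fix S :: "(real^'n) set"
  assume "S \<in> sets lborel"
  then have [measurable]: "S \<in> sets borel"
    by simp
  have [measurable]: "(\<lambda>x. t + A *v x) \<in> borel_measurable borel"
    by (intro borel_measurable_continuous_onI continuous_intros matrix_vector_mult_linear_continuous_on)
  have "emeasure lborel S = (\<integral>\<^sup>+x. indicator S x \<partial>distr lborel borel ((+) t))"
    by (simp add: lborel_distr_plus)
  also have "\<dots> = (\<integral>\<^sup>+x. indicator S (t + x) \<partial>lborel)"
    by (subst nn_integral_distr) simp_all
  also have "\<dots> = ennreal \<bar>det A\<bar> * (\<integral>\<^sup>+x. indicator S (t + A *v x) \<partial>lborel)"
    by (rule nn_integral_lborel_matrix[OF assms]) simp
  also have "(\<integral>\<^sup>+x. indicator S (t + A *v x) \<partial>lborel) = (\<integral>\<^sup>+x. indicator S x \<partial>distr lborel borel (\<lambda>x. t + A *v x))"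
    by (subst nn_integral_distr) simp_all
  finally show "emeasure lborel S = emeasure (density (distr lborel borel (\<lambda>x. t + A *v x)) (\<lambda>_. ennreal \<bar>det A\<bar>)) S"
    by (simp add: emeasure_density nn_integral_cmult)
qed simp

lemma has_bochner_integral_lborel_affine_matrix:
  fixes A :: "real^'n^'n" and f :: "real^'n \<Rightarrow> 'b::{banach, second_countable_topology}"
  assumes "det A \<noteq> 0" and [measurable]: "f \<in> borel_measurable borel"
    and "has_bochner_integral lborel (\<lambda>x. f (t + A *v x)) i"
  shows "has_bochner_integral lborel f (\<bar>det A\<bar> *\<^sub>R i)"
proof -
  have [measurable]: "(\<lambda>x. t + A *v x) \<in> borel_measurable borel"
    by (intro borel_measurable_continuous_onI continuous_intros matrix_vector_mult_linear_continuous_on)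
  have "has_bochner_integral (distr lborel borel (\<lambda>x. t + A *v x)) f i"
    using assms by (simp add: has_bochner_integral_distr)
  then have "has_bochner_integral (distr lborel borel (\<lambda>x. t + A *v x)) (\<lambda>x. \<bar>det A\<bar> *\<^sub>R f x) (\<bar>det A\<bar> *\<^sub>R i)"
    by (intro has_bochner_integral_scaleR_right)
  then show ?thesis
    by (subst lborel_affine_matrix[OF assms(1), of t]) (auto intro!: has_bochner_integral_density)
qed

subsection \<open>Second moments of the standard normal density\<close>

text \<open>Fubini for an integrand that factors over the coordinates, with \<open>lborel\<close>
  seen as the image of a product measure.\<close>

lemma has_bochner_integral_lborel_prod:
  fixes f :: "'a::euclidean_space \<Rightarrow> real \<Rightarrow> real"
  assumes "\<And>b. b \<in> Basis \<Longrightarrow> has_bochner_integral lborel (f b) (i b)"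
  shows "has_bochner_integral lborel (\<lambda>x. \<Prod>b\<in>Basis. f b (x \<bullet> b)) (\<Prod>b\<in>Basis. i b)"
proof -
  interpret product_sigma_finite "\<lambda>_::'a. lborel :: real measure"
    by unfold_locales
  have int: "integrable lborel (f b)" "integral\<^sup>L lborel (f b) = i b" if "b \<in> Basis" for b
    using assms[OF that] by (auto simp: has_bochner_integral_iff)
  have [measurable]: "f b \<in> borel_measurable borel" if "b \<in> Basis" for b
    using borel_measurable_integrable[OF int(1)[OF that]] by simp
  have "has_bochner_integral (\<Pi>\<^sub>M b\<in>Basis. lborel) (\<lambda>x. \<Prod>b\<in>Basis. f b (x b)) (\<Prod>b\<in>Basis. i b)"
    using int by (simp add: has_bochner_integral_iff product_integrable_prod product_integral_prod)
  then show ?thesis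
    by (subst lborel_eq) (simp add: has_bochner_integral_distr)
qed

text \<open>A mixed moment is the product of one-dimensional ones, and those of order 0, 1, 2 are 1,
  0, 1. One exponent equal to 1 makes the product vanish.\<close>

lemma has_bochner_integral_std_normal_powers:
  fixes p :: "'a::euclidean_space \<Rightarrow> nat"
  assumes "\<And>b. p b \<le> 2"
  shows "has_bochner_integral lborel
    (\<lambda>x. (\<Prod>b\<in>Basis. std_normal_density (x \<bullet> b)) * (\<Prod>b\<in>Basis. (x \<bullet> b) ^ p b))
    (if \<exists>b\<in>Basis. p b = 1 then 0 else 1)"
proof -
  have "has_bochner_integral lborel (\<lambda>x. std_normal_density x * x ^ p b) (if p b = 1 then 0 else 1)" for b
  proof -
    consider "p b = 0" | "p b = 1" | "p b = 2"
      using assms[of b] by linarith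
    then show ?thesis
      using std_normal_moment_even[of 0] std_normal_moment_odd[of 0] std_normal_moment_even[of 1]
      by cases (simp_all add: fact_numeral)
  qed
  then have "has_bochner_integral lborel
      (\<lambda>x. \<Prod>b\<in>Basis. std_normal_density (x \<bullet> b) * (x \<bullet> b) ^ p b) (\<Prod>b\<in>Basis. if p b = 1 then 0 else 1)"
    by (intro has_bochner_integral_lborel_prod)
  moreover have "(\<Prod>b\<in>Basis. if p b = 1 then 0 else 1) = (if \<exists>b\<in>Basis. p b = 1 then 0 else (1::real))"
    by (auto intro: prod.neutral)
  ultimately show ?thesis
    by (simp add: prod.distrib)
qed

text \<open>Expanding the square leaves moments of order at most two; the linear and the
  off-diagonal terms vanish.\<close>

lemma has_bochner_integral_std_normal_affine_square:
  fixes v :: "'a::euclidean_space"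
  shows "has_bochner_integral lborel
    (\<lambda>x. (\<Prod>b\<in>Basis. std_normal_density (x \<bullet> b)) * (c + v \<bullet> x)\<^sup>2) (c\<^sup>2 + v \<bullet> v)"
proof -
  let ?\<phi> = "\<lambda>x::'a. \<Prod>b\<in>Basis. std_normal_density (x \<bullet> b)"
  \<comment> \<open>Writes one coordinate as a full product of powers, the shape of the moment
    lemma.\<close>
  have pow: "(\<Prod>b\<in>Basis. (x \<bullet> b) ^ of_bool (b = k)) = x \<bullet> k" if "k \<in> Basis" for x k :: 'a
    using that by (simp add: prod.delta if_distrib of_bool_def cong: if_cong)
  have m0: "has_bochner_integral lborel ?\<phi> 1"
    using has_bochner_integral_std_normal_powers[of "\<lambda>_::'a. 0"] by simp
  have m1: "has_bochner_integral lborel (\<lambda>x. ?\<phi> x * (x \<bullet> j)) 0" if "j \<in> Basis" for j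
  proof -
    have "has_bochner_integral lborel (\<lambda>x. ?\<phi> x * (\<Prod>b\<in>Basis. (x \<bullet> b) ^ of_bool (b = j)))
        (if \<exists>b\<in>Basis. of_bool (b = j) = (1::nat) then 0 else 1)"
      by (rule has_bochner_integral_std_normal_powers) simp
    then show ?thesis
      using that by (simp add: pow del: One_nat_def)
  qed
  have m2: "has_bochner_integral lborel (\<lambda>x. ?\<phi> x * ((x \<bullet> j) * (x \<bullet> k))) (of_bool (j = k))"
    if "j \<in> Basis" "k \<in> Basis" for j k
  proof -
    have "has_bochner_integral lborel
        (\<lambda>x. ?\<phi> x * (\<Prod>b\<in>Basis. (x \<bullet> b) ^ (of_bool (b = j) + of_bool (b = k))))
        (if \<exists>b\<in>Basis. of_bool (b = j) + of_bool (b = k) = (1::nat) then 0 else 1)"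
      by (rule has_bochner_integral_std_normal_powers) simp
    \<comment> \<open>For \<open>j = k\<close> the exponents are 2 at \<open>j\<close> and 0
      elsewhere; for \<open>j \<noteq> k\<close> the exponent 1 occurs.\<close>
    moreover have "(\<exists>b\<in>Basis. of_bool (b = j) + of_bool (b = k) = (1::nat)) \<longleftrightarrow> j \<noteq> k"
      using that by auto
    ultimately show ?thesis
      using that by (simp add: power_add prod.distrib pow del: One_nat_def split: if_splits)
  qed
  have "has_bochner_integral lborel
      (\<lambda>x. c\<^sup>2 * ?\<phi> x + (\<Sum>j\<in>Basis. (2 * c * (v \<bullet> j)) * (?\<phi> x * (x \<bullet> j))) +
        (\<Sum>j\<in>Basis. \<Sum>k\<in>Basis. ((v \<bullet> j) * (v \<bullet> k)) * (?\<phi> x * ((x \<bullet> j) * (x \<bullet> k)))))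
      (c\<^sup>2 * 1 + (\<Sum>j\<in>Basis. (2 * c * (v \<bullet> j)) * 0) +
        (\<Sum>j\<in>Basis. \<Sum>k\<in>Basis. ((v \<bullet> j) * (v \<bullet> k)) * of_bool (j = k)))"
    by (intro has_bochner_integral_add has_bochner_integral_sum has_bochner_integral_mult_right m0 m1 m2)
  moreover have "?\<phi> x * (c + v \<bullet> x)\<^sup>2 =
      c\<^sup>2 * ?\<phi> x + (\<Sum>j\<in>Basis. (2 * c * (v \<bullet> j)) * (?\<phi> x * (x \<bullet> j))) +
        (\<Sum>j\<in>Basis. \<Sum>k\<in>Basis. ((v \<bullet> j) * (v \<bullet> k)) * (?\<phi> x * ((x \<bullet> j) * (x \<bullet> k))))" for x
  proof -
    have 1: "(\<Sum>j\<in>Basis. (2 * c * (v \<bullet> j)) * (?\<phi> x * (x \<bullet> j))) = ?\<phi> x * (2 * c * (v \<bullet> x))"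
      by (subst euclidean_inner[of v x]) (simp add: sum_distrib_left mult_ac)
    have 2: "(\<Sum>j\<in>Basis. \<Sum>k\<in>Basis. ((v \<bullet> j) * (v \<bullet> k)) * (?\<phi> x * ((x \<bullet> j) * (x \<bullet> k)))) =
        ?\<phi> x * ((v \<bullet> x) * (v \<bullet> x))"
      unfolding euclidean_inner[of v x] sum_product by (simp add: sum_distrib_left mult_ac)
    show ?thesis
      unfolding 1 2 by (simp add: power2_eq_square algebra_simps)
  qed
  moreover have "(\<Sum>j\<in>Basis. \<Sum>k\<in>Basis. ((v \<bullet> j) * (v \<bullet> k)) * of_bool (j = k)) = v \<bullet> v"
    by (subst euclidean_inner) (simp add: of_bool_def if_distrib sum.delta cong: if_cong)
  ultimately show ?thesis
    by simp
qed

lemma prod_std_normal_density: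
  fixes x :: "'a::euclidean_space"
  shows "(\<Prod>b\<in>Basis. std_normal_density (x \<bullet> b)) = exp (- (x \<bullet> x) / 2) / sqrt ((2 * pi) ^ DIM('a))"
proof -
  have "(\<Prod>b\<in>Basis. std_normal_density (x \<bullet> b)) = (1 / sqrt (2 * pi)) ^ DIM('a) * exp (\<Sum>b\<in>Basis. - (x \<bullet> b)\<^sup>2 / 2)"
    by (simp add: std_normal_density_def prod.distrib exp_sum prod_dividef power_divide)
  also have "(\<Sum>b\<in>Basis. - (x \<bullet> b)\<^sup>2 / 2) = - (x \<bullet> x) / 2"
    by (subst (2) euclidean_inner) (simp add: sum_negf sum_divide_distrib power2_eq_square)
  finally show ?thesis
    by (simp only: real_sqrt_power power_divide power_one) simp
qed

subsection \<open>Factorization of positive definite matrices\<close>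

lemma pos_def_matrix_inner_commute:
  fixes A :: "real^'n^'n"
  assumes "pos_def_matrix A"
  shows "u \<bullet> (A *v v) = v \<bullet> (A *v u)"
  using assms by (metis dot_lmul_matrix inner_commute pos_def_matrix_def transpose_matrix_vector)

text \<open>Gram-Schmidt for the inner product \<open>u \<bullet> (A *v v)\<close>, by induction on
  the set of indices already treated.\<close>

lemma pos_def_matrix_orthonormal_extend:
  fixes A :: "real^'n^'n"
  assumes "pos_def_matrix A"
  shows "finite J \<Longrightarrow> \<exists>b. \<forall>i\<in>J. \<forall>j\<in>J. b i \<bullet> (A *v b j) = of_bool (i = (j::'n))"
proof (induction J rule: finite_induct)
  case (insert k J)
  then obtain b where b: "b i \<bullet> (A *v b j) = of_bool (i = j)" if "i \<in> J" "j \<in> J" for i j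
    by metis
  \<comment> \<open>Fewer vectors than the dimension cannot span, which yields a \<open>v\<close>
    outside their span.\<close>
  have "card J < CARD('n)"
    using insert.hyps by (metis UNIV_I finite psubset_card_mono psubsetI subset_UNIV)
  then have "dim (b ` J) < CARD('n)"
    by (meson card_image_le dim_le_card' finite finite_imageI le_less_trans)
  then have "span (b ` J) \<noteq> UNIV"
    by (metis dim_UNIV dim_span less_irrefl DIM_cart DIM_real mult_1_right)
  then obtain v where v: "v \<notin> span (b ` J)"
    by blast
  \<comment> \<open>Removing the \<open>A\<close>-projections makes \<open>w\<close> orthogonal to
    the earlier vectors; it stays nonzero since \<open>v\<close> is outside their span, so it can be
    normalized.\<close>
  define w where "w = v - (\<Sum>j\<in>J. (v \<bullet> (A *v b j)) *\<^sub>R b j)"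
  have "w \<noteq> 0"
  proof
    assume "w = 0"
    then have "v = (\<Sum>j\<in>J. (v \<bullet> (A *v b j)) *\<^sub>R b j)"
      by (simp add: w_def)
    also have "\<dots> \<in> span (b ` J)"
      by (intro span_sum span_mul span_base) auto
    finally show False
      using v by simp
  qed
  have pos: "w \<bullet> (A *v w) > 0"
    using assms \<open>w \<noteq> 0\<close> by (simp add: pos_def_matrix_def)
  have orth: "w \<bullet> (A *v b i) = 0" if "i \<in> J" for i
    using that insert.hyps
    by (simp add: w_def inner_diff_left inner_sum_left b if_distrib of_bool_def cong: if_cong)
  define b' where "b' = b(k := (1 / sqrt (w \<bullet> (A *v w))) *\<^sub>R w)"
  have "b' i \<bullet> (A *v b' j) = of_bool (i = j)" if "i \<in> insert k J" "j \<in> insert k J" for i j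
    using that insert.hyps pos orth b pos_def_matrix_inner_commute[OF assms, of "b i" w]
    by (auto simp: b'_def matrix_vector_mult_scaleR)
  then show ?case
    by blast
qed auto

text \<open>With an \<open>A\<close>-orthonormal basis as the rows of \<open>P\<close>, the matrix
  \<open>P ** A ** transpose P\<close> is the identity, and the inverse of \<open>P\<close> is the
  factor sought.\<close>

lemma pos_def_matrix_factorization:
  fixes A :: "real^'n^'n"
  assumes "pos_def_matrix A"
  obtains S :: "real^'n^'n" where "A = S ** transpose S" "invertible S"
proof -
  obtain b :: "'n \<Rightarrow> real^'n" where b: "\<And>i j. b i \<bullet> (A *v b j) = of_bool (i = j)"
    using pos_def_matrix_orthonormal_extend[OF assms, of UNIV] by auto
  define P where "P = (\<chi> i. b i)"
  have P: "P ** A ** transpose P = mat 1"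
  proof -
    have "(P ** A ** transpose P) $ i $ j = b i \<bullet> (A *v b j)" for i j
      unfolding matrix_mul_assoc[symmetric]
      by (simp add: P_def inner_vec_def matrix_matrix_mult_def matrix_vector_mult_def transpose_def)
    then show ?thesis
      by (simp add: vec_eq_iff mat_def b)
  qed
  \<comment> \<open>\<open>A ** transpose P\<close> is a right inverse of the square matrix
    \<open>P\<close>.\<close>
  then have "invertible P"
    by (metis invertible_right_inverse matrix_mul_assoc)
  then obtain S where S: "P ** S = mat 1" "S ** P = mat 1"
    by (auto simp: invertible_def)
  then have T: "transpose P ** transpose S = mat 1"
    by (metis matrix_transpose_mul transpose_mat)
  have "A = (S ** P) ** A ** (transpose P ** transpose S)"
    by (simp add: S T)
  also have "\<dots> = S ** (P ** A ** transpose P) ** transpose S"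
    by (simp only: matrix_mul_assoc)
  finally have "A = S ** transpose S"
    by (simp add: P)
  moreover have "invertible S"
    using S by (auto simp: invertible_def)
  ultimately show ?thesis
    by (rule that)
qed

subsection \<open>The smoothed objective\<close>

text \<open>In the coordinate \<open>w\<close> the quadratic form becomes
  \<open>w \<bullet> w\<close>, and the root of the determinant contributes
  \<open>\<bar>det S\<bar>\<close>.\<close>

lemma normal_kernel_factorization:
  fixes S :: "real^'n^'n"
  assumes "invertible S"
  shows "normal_kernel (S ** transpose S) (S *v w) =
    (\<Prod>b\<in>Basis. std_normal_density (w \<bullet> b)) / \<bar>det S\<bar>"
proof -
  let ?A = "S ** transpose S"
  obtain Q where Q: "S ** Q = mat 1" "Q ** S = mat 1"
    using assms by (auto simp: invertible_def)
  have T: "transpose S ** transpose Q = mat 1"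
    by (metis Q(2) matrix_transpose_mul transpose_mat)
  have "invertible ?A"
    using assms by (simp add: invertible_mult transpose_invertible)
  then have inv: "matrix_inv ?A ** ?A = mat 1"
    unfolding invertible_def matrix_inv_def by (rule someI2_ex) simp
  \<comment> \<open>Exhibiting \<open>S *v w\<close> as a value of \<open>?A\<close> lets
    \<open>matrix_inv ?A\<close> cancel without being computed.\<close>
  have "S *v w = S *v ((transpose S ** transpose Q) *v w)"
    by (simp add: T)
  also have "\<dots> = ?A *v (transpose Q *v w)"
    by (simp only: matrix_vector_mul_assoc matrix_mul_assoc)
  finally have "matrix_inv ?A *v (S *v w) = transpose Q *v w"
    by (metis inv matrix_vector_mul_assoc matrix_vector_mul_lid)
  then have "(S *v w) \<bullet> (matrix_inv ?A *v (S *v w)) = w \<bullet> (transpose S *v (transpose Q *v w))"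
    by (simp add: dot_lmul_matrix inner_commute[of "S *v w"] inner_commute[of w])
  also have "\<dots> = w \<bullet> w"
    by (simp only: matrix_vector_mul_assoc T matrix_vector_mul_lid)
  finally show ?thesis
    by (simp add: normal_kernel_def prod_std_normal_density det_mul real_sqrt_mult)
qed

lemma has_bochner_integral_square_normal_kernel:
  fixes A :: "real^'n^'n"
  assumes "pos_def_matrix A" and "h > 0"
  shows "has_bochner_integral lborel
    (\<lambda>x. (b \<bullet> x)\<^sup>2 * normal_kernel A ((1 / h) *\<^sub>R (t - x)) * (1 / h ^ CARD('n)))
    ((b \<bullet> t)\<^sup>2 + h\<^sup>2 * (b \<bullet> (A *v b)))"
proof -
  obtain S :: "real^'n^'n" where A: "A = S ** transpose S" and S: "invertible S"
    using pos_def_matrix_factorization[OF assms(1)] .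
  let ?f = "\<lambda>x. (b \<bullet> x)\<^sup>2 * normal_kernel A ((1 / h) *\<^sub>R (t - x)) * (1 / h ^ CARD('n))"
  \<comment> \<open>The sign makes the kernel argument at \<open>t + M *v w\<close> exactly
    \<open>S *v w\<close>.\<close>
  define M where "M = (- h) *\<^sub>R S"
  \<comment> \<open>This is the transpose of \<open>M\<close> applied to \<open>b\<close>.\<close>
  define v where "v = (- h) *\<^sub>R (b v* S)"
  have "M = (\<chi> i. (- h) *s S $ i)"
    by (simp add: M_def vec_eq_iff)
  then have "det M = (- h) ^ CARD('n) * det S"
    using det_rows_mul[of "\<lambda>_. - h" "\<lambda>i. S $ i"] by simp
  then have det: "\<bar>det M\<bar> = h ^ CARD('n) * \<bar>det S\<bar>" "det S \<noteq> 0" "det M \<noteq> 0"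
    using assms(2) S by (auto simp: abs_mult power_abs invertible_det_nz)
  have M: "M *v w = - h *\<^sub>R (S *v w)" for w
    by (simp add: M_def scaleR_matrix_vector_assoc)
  have bM: "b \<bullet> (M *v w) = v \<bullet> w" for w
    by (simp add: v_def M dot_lmul_matrix)
  have "v \<bullet> v = h\<^sup>2 * ((b v* S) \<bullet> (transpose S *v b))"
    by (simp add: v_def power2_eq_square)
  also have "\<dots> = h\<^sup>2 * (b \<bullet> (A *v b))"
    by (simp only: dot_lmul_matrix A matrix_vector_mul_assoc)
  finally have v: "v \<bullet> v = h\<^sup>2 * (b \<bullet> (A *v b))" .
  have "(1 / h) *\<^sub>R (t - (t + M *v w)) = S *v w" for w
    using assms(2) by (simp add: M)
  \<comment> \<open>The bandwidth factor and the \<open>1 / \<bar>det S\<bar>\<close> of the kernel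
    combine to \<open>1 / \<bar>det M\<bar>\<close>, which the Jacobian cancels at the end.\<close>
  then have "?f (t + M *v w) =
      (\<Prod>b\<in>Basis. std_normal_density (w \<bullet> b)) * (b \<bullet> t + v \<bullet> w)\<^sup>2 * (1 / \<bar>det M\<bar>)" for w
    by (simp add: A normal_kernel_factorization[OF S] inner_add_right bM det(1) mult_ac)
  then have "has_bochner_integral lborel (\<lambda>w. ?f (t + M *v w))
      (((b \<bullet> t)\<^sup>2 + v \<bullet> v) * (1 / \<bar>det M\<bar>))"
    by (simp only:) (intro has_bochner_integral_mult_left has_bochner_integral_std_normal_affine_square)
  moreover have "?f \<in> borel_measurable borel"
    unfolding normal_kernel_def
    by (intro borel_measurable_continuous_onI continuous_intros matrix_vector_mult_linear_continuous_on
        continuous_on_compose2[OF matrix_vector_mult_linear_continuous_on[of UNIV]]) auto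
  ultimately have "has_bochner_integral lborel ?f
      (\<bar>det M\<bar> *\<^sub>R (((b \<bullet> t)\<^sup>2 + v \<bullet> v) * (1 / \<bar>det M\<bar>)))"
    by (intro has_bochner_integral_lborel_affine_matrix[OF det(3)])
  then show ?thesis
    using det(3) by (simp add: v)
qed

lemma inner_prepend: "prepend c u \<bullet> prepend d v = c * d + u \<bullet> v"
  by (simp add: prepend_def inner_vec_def UNIV_option_conv sum.reindex)

lemma weighted_norm_power2:
  assumes "pos_def_matrix A"
  shows "(weighted_norm A v)\<^sup>2 = v \<bullet> (A *v v)"
proof -
  have "v \<bullet> (A *v v) \<ge> 0"
    using assms by (cases "v = 0") (auto simp: pos_def_matrix_def less_imp_le)
  then show ?thesis
    by (simp add: weighted_norm_def)
qed

theorem corollary10: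
  fixes X :: "nat \<Rightarrow> real^'m" and y :: "nat \<Rightarrow> real" and N :: nat
    and t h :: real and A :: "real^('m option)^('m option)"
  assumes "t > 0" and "h > 0" and "pos_def_matrix A"
  shows "(\<forall>\<beta>. \<forall>i\<in>{1..N}. integrable lborel (smoothed_integrand A h (X i) (y i) \<beta>)) \<and>
         equivalent_problems
           (l1_ball t) (smoothed_objective A h N X y)
           (l1_ball t) (regularized_objective A (h\<^sup>2) N X y)"
proof -
  \<comment> \<open>Integrability is recorded with the value, since \<open>integral\<^sup>L\<close>
    defaults to 0 on non-integrable functions. The inner product is minus the residual; squaring
    removes the sign.\<close>
  have int: "has_bochner_integral lborel (smoothed_integrand A h (X i) (y i) \<beta>)
      ((y i - \<beta> \<bullet> X i)\<^sup>2 + h\<^sup>2 * (weighted_norm A (prepend (-1) \<beta>))\<^sup>2)" for i \<beta>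
    using has_bochner_integral_square_normal_kernel[OF assms(3,2), of "prepend (-1) \<beta>" "prepend (y i) (X i)"]
    by (simp add: smoothed_integrand_def[abs_def] inner_prepend weighted_norm_power2[OF assms(3)] power2_commute)
  \<comment> \<open>The objectives agree at every \<open>\<beta>\<close>, feasible or not, so all
    three parts of the equivalence become reflexive.\<close>
  have "smoothed_objective A h N X y = regularized_objective A (h\<^sup>2) N X y"
    unfolding smoothed_objective_def regularized_objective_def
    by (simp only: has_bochner_integral_integral_eq[OF int])
  with int show ?thesis
    by (auto simp: equivalent_problems_def intro: integrable.intros)
qed

end
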